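(* Let $X$, $(\Omega,\mathbb{R})$, $\Pi_t$ and $G$ be as in the context. Assume: $\Omega$ is minimal; $G$ is connected and its action on $X$ is order-preserving; $\Pi_t$ is monotone and the action of $G$ commutes with $\Pi_t$; and assume that $G$ is locally compact. Let $K=\{(\bar u_\omega,\omega):\omega\in\Omega\}\subset X\times\Omega$ be a minimal set of $\Pi_t$ which is a uniformly stable $1$-cover of $\Omega$, and assume that there exists $\delta>0$ such that (i) the forward orbit $O^+(x_0,\omega_0)$ is relatively compact for every $(x_0,\omega_0)\in B_\delta(K)$; and (ii) whenever (for such a point) the omega-limit set satisfies $\mathcal{O}(x_0,\omega_0)\subset B_\delta(K)$ and $\mathcal{O}(x_0,\omega_0)\prec hK$ (resp. $\mathcal{O}(x_0,\omega_0)\succ hK$) for some $h\in G$, there is a neighborhood $B(e)\subset G$ of the unit $e$ such that $\mathcal{O}(x_0,\omega_0)\prec ghK$ (resp. $\mathcal{O}(x_0,\omega_0)\succ ghK$) for all $g\in B(e)$. If $GK\ne K$, then there is $\delta_*\in(0,\delta)$ such that for every $(x,\omega)\in B_{\delta_*}(K)$ there is $h\in G$ with $\mathcal{O}(x,\omega)=hK$, and moreover $$\|u(t,x,\omega)-h\bar u_{\omega\cdot t}\|\to0\quad\text{as }t\to\infty.$$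
   Context: Ordered space: $(V,\|\cdot\|)$ is a Banach space ordered by a closed convex cone $V_+$ with $V_+\cap(-V_+)=\{0\}$; $x_1\le x_2$ iff $x_2-x_1\in V_+$, and $x_1<x_2$ iff $x_1\le x_2$ and $x_1\ne x_2$. $X\subset V$ is a closed order convex subset (order convex: for $a<b$ in $X$ the segment $\{a+s(b-a):s\in[0,1]\}$ lies in $X$). Standing assumption: for all $u,v\in X$ the greatest lower bound $u\wedge v$ exists, and $(u,v)\mapsto u\wedge v$ is continuous $X\times X\to X$. Base flow: $\Omega$ is a compact metric space with a continuous flow $(\omega,t)\mapsto\omega\cdot t$, $t\in\mathbb{R}$; it is minimal if it has no nonempty proper compact invariant subset. Skew-product semiflow: $\Pi_t(x,\omega)=(u(t,x,\omega),\omega\cdot t)$, $t\ge0$, is a continuous map $\mathbb{R}^+\times X\times\Omega\to X\times\Omega$ with $\Pi_0=\mathrm{Id}$ and $u(t+s,x,\omega)=u(s,u(t,x,\omega),\omega\cdot t)$. It is monotone if $x_1\le x_2$ implies $u(t,x_1,\omega)\le u(t,x_2,\omega)$ for all $\omega\in\Omega$, $t\ge0$. Forward orbit: $O^+(x,\omega)=\{\Pi_t(x,\omega):t\ge0\}$. Omega-limit set: $\mathcal{O}(x,\omega)$ is the set of limits of $\Pi_{t_n}(x,\omega)$ over sequences $t_n\to\infty$. 1-cover: a compact positively invariant $K\subset X\times\Omega$ such that over every $\omega\in\Omega$ there is exactly one point $(\bar u_\omega,\omega)$ of $K$; then $\omega\mapsto\bar u_\omega$ is continuous and $u(t,\bar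 u_\omega,\omega)=\bar u_{\omega\cdot t}$ for $t\ge0$. $K$ is uniformly stable if for every $\varepsilon>0$ there is $\delta(\varepsilon)>0$ such that for $(x,\omega)\in K$, $(y,\omega)\in X\times\Omega$ with $\|x-y\|\le\delta(\varepsilon)$ one has $\|u(t,x,\omega)-u(t,y,\omega)\|<\varepsilon$ for all $t\ge0$. For $r>0$, $B_r(K)=\{(x,\omega)\in X\times\Omega:\|x-\bar u_\omega\|<r\}$. Order of sets: for compact positively invariant $K_1,K_2\subset X\times\Omega$, $K_1\preceq K_2$ (resp. $K_1\prec K_2$) means: for every $(x,\omega)\in K_1$ there is $(y,\omega)\in K_2$ with $x\le y$ (resp. $x<y$), and for every $(y,\omega)\in K_2$ there is $(x,\omega)\in K_1$ with $x\le y$ (resp. $x<y$). $K_1\succeq K_2$, $K_1\succ K_2$ are defined analogously. Group action: $G$ is a metrizable topological group with unit $e$, acting continuously on $X$ ($G\times X\to X$, $(a,x)\mapsto ax$, by homeomorphisms, with $a\mapsto(x\mapsto ax)$ a group homomorphism). The action is order-preserving if $x_1\le x_2$ implies $ax_1\le ax_2$; it commutes with $\Pi_t$ if $a\,u(t,x,\omega)=u(t,ax,\omega)$ for all $a\in G$, $(x,\omega)\in X\times\Omega$, $t\ge0$. $gK=\{(g\bar u_\omega,\omega):\omega\in\Omega\}$, $GK=\{(g\bar u_\omega,\omega):g\in G,\ \omega\in\Omega\}$. *)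

theory Defs
  imports "HOL-Analysis.Analysis"
begin

text \<open>
  An ordered Banach space is a type of sort \<open>{banach, ordered_real_vector}\<close> whose positive cone
  \<open>{v. 0 \<le> v}\<close> is closed: the class axioms say exactly that this set is a convex cone meeting its
  negative only in \<open>0\<close>, and that \<open>x \<le> y\<close> iff \<open>y - x\<close> lies in it.

  A metrizable topological group is a type of sort \<open>{metric_space, topological_group_add}\<close>.  The
  class \<open>topological_group_add\<close> is not commutative; so the product \<open>g h\<close> is written \<open>g + h\<close>,
  and the unit \<open>e\<close> is \<open>0\<close>.
\<close>

section \<open>The state space\<close>

definition order_convex :: "'v::ordered_real_vector set \<Rightarrow> bool" where
  "order_convex X \<longleftrightarrow> (\<forall>a\<in>X. \<forall>b\<in>X. a < b \<longrightarrow> closed_segment a b \<subseteq> X)"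

text \<open>Greatest lower bounds are taken in the ordered set \<open>X\<close>.\<close>

definition glb_in :: "'v::order set \<Rightarrow> 'v \<Rightarrow> 'v \<Rightarrow> 'v \<Rightarrow> bool" where
  "glb_in X u v w \<longleftrightarrow>
     w \<in> X \<and> w \<le> u \<and> w \<le> v \<and> (\<forall>z\<in>X. z \<le> u \<and> z \<le> v \<longrightarrow> z \<le> w)"

definition meet_in :: "'v::order set \<Rightarrow> 'v \<Rightarrow> 'v \<Rightarrow> 'v" where
  "meet_in X u v = (THE w. glb_in X u v w)"

definition has_continuous_meets :: "'v::{order, topological_space} set \<Rightarrow> bool" where
  "has_continuous_meets X \<longleftrightarrow>
     (\<forall>u\<in>X. \<forall>v\<in>X. \<exists>w. glb_in X u v w) \<and>
     continuous_on (X \<times> X) (\<lambda>(u, v). meet_in X u v)"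

section \<open>The base flow\<close>

definition continuous_flow :: "'w::topological_space set \<Rightarrow> ('w \<Rightarrow> real \<Rightarrow> 'w) \<Rightarrow> bool" where
  "continuous_flow \<Omega> \<phi> \<longleftrightarrow>
     (\<forall>\<omega>\<in>\<Omega>. \<forall>t. \<phi> \<omega> t \<in> \<Omega>) \<and>
     (\<forall>\<omega>\<in>\<Omega>. \<phi> \<omega> 0 = \<omega>) \<and>
     (\<forall>\<omega>\<in>\<Omega>. \<forall>s t. \<phi> \<omega> (s + t) = \<phi> (\<phi> \<omega> s) t) \<and>
     continuous_on (\<Omega> \<times> UNIV) (\<lambda>(\<omega>, t). \<phi> \<omega> t)"

definition minimal_flow :: "'w::topological_space set \<Rightarrow> ('w \<Rightarrow> real \<Rightarrow> 'w) \<Rightarrow> bool" where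
  "minimal_flow \<Omega> \<phi> \<longleftrightarrow>
     (\<forall>M\<subseteq>\<Omega>. M \<noteq> {} \<and> compact M \<and> (\<forall>t. (\<lambda>\<omega>. \<phi> \<omega> t) ` M = M) \<longrightarrow> M = \<Omega>)"

section \<open>Skew-product semiflows\<close>

definition skew_map ::
  "(real \<Rightarrow> 'v \<Rightarrow> 'w \<Rightarrow> 'v) \<Rightarrow> ('w \<Rightarrow> real \<Rightarrow> 'w) \<Rightarrow> real \<Rightarrow> 'v \<times> 'w \<Rightarrow> 'v \<times> 'w" where
  "skew_map u \<phi> t = (\<lambda>(x, \<omega>). (u t x \<omega>, \<phi> \<omega> t))"

definition skew_product_semiflow ::
  "'v::topological_space set \<Rightarrow> 'w::topological_space set \<Rightarrow>
   (real \<Rightarrow> 'v \<Rightarrow> 'w \<Rightarrow> 'v) \<Rightarrow> ('w \<Rightarrow> real \<Rightarrow> 'w) \<Rightarrow> bool" where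
  "skew_product_semiflow X \<Omega> u \<phi> \<longleftrightarrow>
     (\<forall>t\<ge>0. \<forall>x\<in>X. \<forall>\<omega>\<in>\<Omega>. u t x \<omega> \<in> X) \<and>
     (\<forall>x\<in>X. \<forall>\<omega>\<in>\<Omega>. u 0 x \<omega> = x) \<and>
     (\<forall>s\<ge>0. \<forall>t\<ge>0. \<forall>x\<in>X. \<forall>\<omega>\<in>\<Omega>. u (t + s) x \<omega> = u s (u t x \<omega>) (\<phi> \<omega> t)) \<and>
     continuous_on ({0..} \<times> (X \<times> \<Omega>)) (\<lambda>(t, p). skew_map u \<phi> t p)"

definition monotone_semiflow ::
  "'v::order set \<Rightarrow> 'w set \<Rightarrow> (real \<Rightarrow> 'v \<Rightarrow> 'w \<Rightarrow> 'v) \<Rightarrow> bool" where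
  "monotone_semiflow X \<Omega> u \<longleftrightarrow>
     (\<forall>t\<ge>0. \<forall>\<omega>\<in>\<Omega>. \<forall>x\<in>X. \<forall>y\<in>X. x \<le> y \<longrightarrow> u t x \<omega> \<le> u t y \<omega>)"

definition forward_orbit ::
  "(real \<Rightarrow> 'v \<Rightarrow> 'w \<Rightarrow> 'v) \<Rightarrow> ('w \<Rightarrow> real \<Rightarrow> 'w) \<Rightarrow> 'v \<times> 'w \<Rightarrow> ('v \<times> 'w) set" where
  "forward_orbit u \<phi> p = {skew_map u \<phi> t p | t. 0 \<le> t}"

definition omega_limit ::
  "(real \<Rightarrow> 'v::topological_space \<Rightarrow> 'w::topological_space \<Rightarrow> 'v) \<Rightarrow>
   ('w \<Rightarrow> real \<Rightarrow> 'w) \<Rightarrow> 'v \<times> 'w \<Rightarrow> ('v \<times> 'w) set" where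
  "omega_limit u \<phi> p =
     {q. \<exists>\<tau>::nat \<Rightarrow> real. (\<forall>n. 0 \<le> \<tau> n) \<and> filterlim \<tau> at_top sequentially \<and>
           (\<lambda>n. skew_map u \<phi> (\<tau> n) p) \<longlonglongrightarrow> q}"

definition positively_invariant ::
  "(real \<Rightarrow> 'v \<Rightarrow> 'w \<Rightarrow> 'v) \<Rightarrow> ('w \<Rightarrow> real \<Rightarrow> 'w) \<Rightarrow> ('v \<times> 'w) set \<Rightarrow> bool" where
  "positively_invariant u \<phi> K \<longleftrightarrow> (\<forall>t\<ge>0. skew_map u \<phi> t ` K \<subseteq> K)"

definition minimal_set ::
  "(real \<Rightarrow> 'v::topological_space \<Rightarrow> 'w::topological_space \<Rightarrow> 'v) \<Rightarrow>
   ('w \<Rightarrow> real \<Rightarrow> 'w) \<Rightarrow> ('v \<times> 'w) set \<Rightarrow> bool" where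
  "minimal_set u \<phi> K \<longleftrightarrow>
     K \<noteq> {} \<and> compact K \<and> positively_invariant u \<phi> K \<and>
     (\<forall>M\<subseteq>K. M \<noteq> {} \<and> compact M \<and> positively_invariant u \<phi> M \<longrightarrow> M = K)"

definition one_cover ::
  "'v::topological_space set \<Rightarrow> 'w::topological_space set \<Rightarrow>
   (real \<Rightarrow> 'v \<Rightarrow> 'w \<Rightarrow> 'v) \<Rightarrow> ('w \<Rightarrow> real \<Rightarrow> 'w) \<Rightarrow> ('v \<times> 'w) set \<Rightarrow> bool" where
  "one_cover X \<Omega> u \<phi> K \<longleftrightarrow>
     K \<subseteq> X \<times> \<Omega> \<and> compact K \<and> positively_invariant u \<phi> K \<and>
     (\<forall>\<omega>\<in>\<Omega>. \<exists>!x. (x, \<omega>) \<in> K)"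

definition uniformly_stable ::
  "'v::real_normed_vector set \<Rightarrow> (real \<Rightarrow> 'v \<Rightarrow> 'w \<Rightarrow> 'v) \<Rightarrow> ('v \<times> 'w) set \<Rightarrow> bool" where
  "uniformly_stable X u K \<longleftrightarrow>
     (\<forall>\<epsilon>>0. \<exists>\<delta>>0. \<forall>(x, \<omega>)\<in>K. \<forall>y\<in>X. norm (x - y) \<le> \<delta> \<longrightarrow>
        (\<forall>t\<ge>0. norm (u t x \<omega> - u t y \<omega>) < \<epsilon>))"

definition graph_over :: "'w set \<Rightarrow> ('w \<Rightarrow> 'v) \<Rightarrow> ('v \<times> 'w) set" where
  "graph_over \<Omega> b = {(b \<omega>, \<omega>) | \<omega>. \<omega> \<in> \<Omega>}"

definition tube ::
  "'v::real_normed_vector set \<Rightarrow> 'w set \<Rightarrow> ('w \<Rightarrow> 'v) \<Rightarrow> real \<Rightarrow> ('v \<times> 'w) set" where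
  "tube X \<Omega> b r = {(x, \<omega>) \<in> X \<times> \<Omega>. norm (x - b \<omega>) < r}"

definition sets_less :: "('v::order \<times> 'w) set \<Rightarrow> ('v \<times> 'w) set \<Rightarrow> bool" where
  "sets_less K\<^sub>1 K\<^sub>2 \<longleftrightarrow>
     (\<forall>(x, \<omega>)\<in>K\<^sub>1. \<exists>y. (y, \<omega>) \<in> K\<^sub>2 \<and> x < y) \<and>
     (\<forall>(y, \<omega>)\<in>K\<^sub>2. \<exists>x. (x, \<omega>) \<in> K\<^sub>1 \<and> x < y)"

section \<open>Group actions\<close>

definition continuous_action ::
  "'v::topological_space set \<Rightarrow> ('g::topological_group_add \<Rightarrow> 'v \<Rightarrow> 'v) \<Rightarrow> bool" where
  "continuous_action X act \<longleftrightarrow>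
     (\<forall>g. \<forall>x\<in>X. act g x \<in> X) \<and>
     (\<forall>x\<in>X. act 0 x = x) \<and>
     (\<forall>g h. \<forall>x\<in>X. act (g + h) x = act g (act h x)) \<and>
     continuous_on (UNIV \<times> X) (\<lambda>(g, x). act g x)"

definition order_preserving_action :: "'v::order set \<Rightarrow> ('g \<Rightarrow> 'v \<Rightarrow> 'v) \<Rightarrow> bool" where
  "order_preserving_action X act \<longleftrightarrow>
     (\<forall>g. \<forall>x\<in>X. \<forall>y\<in>X. x \<le> y \<longrightarrow> act g x \<le> act g y)"

definition commutes_with_semiflow ::
  "'v set \<Rightarrow> 'w set \<Rightarrow> (real \<Rightarrow> 'v \<Rightarrow> 'w \<Rightarrow> 'v) \<Rightarrow> ('g \<Rightarrow> 'v \<Rightarrow> 'v) \<Rightarrow> bool" where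
  "commutes_with_semiflow X \<Omega> u act \<longleftrightarrow>
     (\<forall>g. \<forall>t\<ge>0. \<forall>x\<in>X. \<forall>\<omega>\<in>\<Omega>. act g (u t x \<omega>) = u t (act g x) \<omega>)"

definition translate :: "('g \<Rightarrow> 'v \<Rightarrow> 'v) \<Rightarrow> 'g \<Rightarrow> ('v \<times> 'w) set \<Rightarrow> ('v \<times> 'w) set" where
  "translate act g K = (\<lambda>(x, \<omega>). (act g x, \<omega>)) ` K"

definition group_orbit :: "('g \<Rightarrow> 'v \<Rightarrow> 'v) \<Rightarrow> ('v \<times> 'w) set \<Rightarrow> ('v \<times> 'w) set" where
  "group_orbit act K = (\<Union>g. translate act g K)"

end

theory Submission
  imports Defs
begin

text \<open>
  By stability every translate \<open>gK\<close> attracts each orbit whose omega-limit set \<open>O\<close> touches it, so it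
  is enough to find \<open>g\<close> such that \<open>O\<close> meets \<open>gK\<close>.  Suppose that \<open>O\<close> lies below \<open>hK\<close>.  The set \<open>S\<close> of
  all \<open>g\<close> with \<open>O \<prec> gK\<close> is open by hypothesis (ii).  It is not all of \<open>G\<close> when the orbit starts
  near \<open>K\<close>: otherwise, \<open>O\<close> being near \<open>K\<close>, all translates of \<open>K\<close> would lie above \<open>K\<close> and hence
  equal \<open>K\<close>.  As \<open>G\<close> is connected, either \<open>O\<close> meets \<open>hK\<close>, or \<open>S\<close> has a boundary point \<open>g\<close>; then
  \<open>O\<close> lies below \<open>gK\<close>, but not strictly, so it meets \<open>gK\<close>.  The same holds with the order reversed.
  For arbitrary \<open>x\<close> near a point \<open>k\<close> of \<open>K\<close>, the first case captures the orbit of \<open>x \<and> k\<close> by some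
  \<open>hK\<close>, and then \<open>hK\<close> lies below the omega-limit set of \<open>x\<close>, which is the second case.
\<close>

section \<open>Topological preliminaries\<close>

text \<open>Only \<open>c\<close> is confined to the compact set, while \<open>y\<close> ranges over
  \<open>S\<close>; this is what is needed for points of \<open>X\<close> near the compact image of
  the graph. In a sequence of counterexamples the \<open>c n\<close> subconverge in
  \<open>C\<close>, the \<open>y n\<close> are dragged to the same limit, and continuity at that one
  point gives a contradiction.\<close>

lemma uniform_continuity_near_compact:
  fixes f :: "'a::metric_space \<Rightarrow> 'b::metric_space"
  assumes "continuous_on S f" "compact C" "C \<subseteq> S" "\<epsilon> > 0"
  obtains d where "d > 0" "\<And>c y. c \<in> C \<Longrightarrow> y \<in> S \<Longrightarrow> dist c y < d \<Longrightarrow> dist (f c) (f y) < \<epsilon>"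
proof (rule ccontr)
  assume no: "\<not> thesis"
  have "\<exists>c y. c \<in> C \<and> y \<in> S \<and> dist c y < d \<and> \<not> dist (f c) (f y) < \<epsilon>" if "d > 0" for d
    using no that \<open>\<And>d. \<lbrakk>d > 0; \<And>c y. \<lbrakk>c \<in> C; y \<in> S; dist c y < d\<rbrakk> \<Longrightarrow> dist (f c) (f y) < \<epsilon>\<rbrakk> \<Longrightarrow> thesis\<close>
    by blast
  then have "\<exists>c y. c \<in> C \<and> y \<in> S \<and> dist c y < inverse (real (Suc n)) \<and> \<not> dist (f c) (f y) < \<epsilon>" for n
    by simp
  then obtain c y where cy: "\<And>n. c n \<in> C" "\<And>n. y n \<in> S"
    "\<And>n. dist (c n) (y n) < inverse (real (Suc n))" "\<And>n. \<not> dist (f (c n)) (f (y n)) < \<epsilon>"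
    by metis
  obtain l r where l: "l \<in> C" and r: "strict_mono r" and cl: "(c \<circ> r) \<longlonglongrightarrow> l"
    using \<open>compact C\<close> cy(1) unfolding compact_def by metis
  have "(\<lambda>n. dist (c n) (y n)) \<longlonglongrightarrow> 0"
    by (rule tendsto_sandwich[OF _ _ tendsto_const LIMSEQ_inverse_real_of_nat])
      (use cy(3) in \<open>auto intro!: always_eventually less_imp_le simp del: of_nat_Suc\<close>)
  then have "(\<lambda>n. dist (c (r n)) (y (r n))) \<longlonglongrightarrow> 0"
    using LIMSEQ_subseq_LIMSEQ[OF _ r] by (fastforce simp: o_def)
  from tendsto_add[OF this cl[THEN tendsto_dist[OF _ tendsto_const[of l]]]]
  have sum0: "(\<lambda>n. dist (c (r n)) (y (r n)) + dist (c (r n)) l) \<longlonglongrightarrow> 0"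
    by (simp add: o_def)
  have yl: "(\<lambda>n. y (r n)) \<longlonglongrightarrow> l"
    unfolding tendsto_dist_iff[of _ l]
    by (rule tendsto_sandwich[OF _ _ tendsto_const sum0]) (auto intro!: always_eventually dist_triangle3)
  have lim: "(\<lambda>n. f (z n)) \<longlonglongrightarrow> f l" if "z \<longlonglongrightarrow> l" "\<And>n. z n \<in> S" for z :: "nat \<Rightarrow> 'a"
    using continuous_on_tendsto_compose[OF assms(1) that(1)] that(2) l \<open>C \<subseteq> S\<close> by auto
  have "(\<lambda>n. dist (f (c (r n))) (f (y (r n)))) \<longlonglongrightarrow> dist (f l) (f l)"
    using cl yl cy(1,2) \<open>C \<subseteq> S\<close> by (intro tendsto_dist lim) (auto simp: o_def)
  then have "\<forall>\<^sub>F n in sequentially. dist (f (c (r n))) (f (y (r n))) < \<epsilon>"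
    using \<open>\<epsilon> > 0\<close> by (auto intro: order_tendstoD)
  then show False
    using cy(4) by (auto simp: eventually_sequentially)
qed

text \<open>Hypothesis (ii) of the theorem provides neighborhoods of the unit only. The right
  translation \<open>k - h\<close> is continuous and pulls \<open>B\<close> back to a neighborhood
  of \<open>h\<close>.\<close>

lemma open_additive_nbhds:
  fixes S :: "'g::topological_group_add set"
  assumes nbhd: "\<And>h. h \<in> S \<Longrightarrow> \<exists>B. open B \<and> 0 \<in> B \<and> (\<forall>g\<in>B. g + h \<in> S)"
  shows "open S"
proof (rule iffD2[OF open_subopen], rule ballI)
  fix h assume "h \<in> S"
  obtain B where B: "open B" "0 \<in> B" "\<And>g. g \<in> B \<Longrightarrow> g + h \<in> S"
    using nbhd[OF \<open>h \<in> S\<close>] by blast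
  have "continuous_on UNIV (\<lambda>k. k - h)"
    by (intro continuous_on_diff continuous_on_id continuous_on_const)
  then have "open ((\<lambda>k. k - h) -` B)"
    by (intro open_vimage B)
  moreover have "(\<lambda>k. k - h) -` B \<subseteq> S"
  proof
    fix k assume "k \<in> (\<lambda>k. k - h) -` B"
    then show "k \<in> S" using B(3)[of "k - h"] by simp
  qed
  ultimately show "\<exists>T. open T \<and> h \<in> T \<and> T \<subseteq> S"
    using B(2) by (intro exI[of _ "(\<lambda>k. k - h) -` B"]) auto
qed

text \<open>In a connected group an open set that is neither empty nor everything cannot be closed,
  so some sequence in it converges to a point outside.\<close>

lemma connected_group_boundary:
  fixes S :: "'g::{metric_space, topological_group_add} set"
  assumes conn: "connected (UNIV :: 'g set)" and "h \<in> S" "k \<notin> S"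
    and nbhd: "\<And>h. h \<in> S \<Longrightarrow> \<exists>B. open B \<and> 0 \<in> B \<and> (\<forall>g\<in>B. g + h \<in> S)"
  obtains s g where "\<And>n. s n \<in> S" "s \<longlonglongrightarrow> g" "g \<notin> S"
proof -
  have "open S"
    by (rule open_additive_nbhds[OF nbhd])
  moreover have "S \<noteq> {}" "S \<noteq> UNIV"
    using assms(2,3) by auto
  ultimately have "\<not> closed S"
    using conn by (auto simp: connected_clopen)
  then show thesis
    using that by (auto simp: closed_sequential_limits)
qed

section \<open>Omega-limit sets\<close>

text \<open>The omega-limit set of \<open>\<omega>\<close> in the base is nonempty, compact and
  invariant for all real times, so minimality makes it all of \<open>\<Omega>\<close>.\<close>

lemma dense_forward_orbit:
  fixes \<Omega> :: "'w::metric_space set"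
  assumes \<Omega>: "compact \<Omega>" and flow: "continuous_flow \<Omega> \<phi>" and min: "minimal_flow \<Omega> \<phi>"
    and w: "\<omega> \<in> \<Omega>" "w \<in> \<Omega>"
  obtains \<tau> :: "nat \<Rightarrow> real" where "\<And>n. 0 \<le> \<tau> n" "filterlim \<tau> at_top sequentially"
    "(\<lambda>n. \<phi> \<omega> (\<tau> n)) \<longlonglongrightarrow> w"
proof -
  \<comment> \<open>The omega-limit set as an intersection of closures, which makes it visibly
    closed; \<open>M_iff\<close> recovers the description by sequences of times.\<close>
  define M where "M = (\<Inter>n::nat. closure (\<phi> \<omega> ` {real n..}))"
  have in_\<Omega>: "\<phi> v t \<in> \<Omega>" if "v \<in> \<Omega>" for v t
    using flow that by (auto simp: continuous_flow_def)
  have add: "\<phi> v (s + t) = \<phi> (\<phi> v s) t" if "v \<in> \<Omega>" for v s t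
    using flow that by (auto simp: continuous_flow_def)
  have zero: "\<phi> v 0 = v" if "v \<in> \<Omega>" for v
    using flow that by (auto simp: continuous_flow_def)
  have cont: "continuous_on \<Omega> (\<lambda>v. \<phi> v t)" for t
  proof -
    have "continuous_on (\<Omega> \<times> UNIV) (\<lambda>(\<omega>, t). \<phi> \<omega> t)"
      using flow by (simp add: continuous_flow_def)
    moreover have "continuous_on \<Omega> (\<lambda>v. (v, t))"
      by (intro continuous_on_Pair continuous_on_id continuous_on_const)
    ultimately show ?thesis
      using continuous_on_compose2[where g = "\<lambda>(\<omega>, t). \<phi> \<omega> t" and f = "\<lambda>v. (v, t)"] by fastforce
  qed
  have M_iff: "v \<in> M \<longleftrightarrow> (\<exists>\<tau>. (\<forall>n. 0 \<le> \<tau> n) \<and> filterlim \<tau> at_top sequentially \<and>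
      (\<lambda>n. \<phi> \<omega> (\<tau> n)) \<longlonglongrightarrow> v)" for v
  proof
    assume "v \<in> M"
    then have "\<exists>t\<ge>real n. dist (\<phi> \<omega> t) v < inverse (real (Suc n))" for n
    proof -
      have "v \<in> closure (\<phi> \<omega> ` {real n..})"
        using \<open>v \<in> M\<close> by (simp add: M_def)
      moreover have "0 < inverse (real (Suc n))" by simp
      ultimately show ?thesis
        unfolding closure_approachable by blast
    qed
    then obtain \<tau> where \<tau>: "\<And>n. \<tau> n \<ge> real n" "\<And>n. dist (\<phi> \<omega> (\<tau> n)) v < inverse (real (Suc n))"
      by metis
    have "filterlim \<tau> at_top sequentially"
      by (rule filterlim_at_top_mono[OF filterlim_real_sequentially]) (simp add: \<tau>)
    moreover have "(\<lambda>n. \<phi> \<omega> (\<tau> n)) \<longlonglongrightarrow> v"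
      by (rule iffD2[OF tendsto_dist_iff],
          rule tendsto_sandwich[OF _ _ tendsto_const LIMSEQ_inverse_real_of_nat])
        (use \<tau>(2) in \<open>auto intro!: always_eventually less_imp_le simp del: of_nat_Suc\<close>)
    moreover have "0 \<le> \<tau> n" for n
      using \<tau>(1)[of n] by (meson of_nat_0_le_iff order_trans)
    ultimately show "\<exists>\<tau>. (\<forall>n. 0 \<le> \<tau> n) \<and> filterlim \<tau> at_top sequentially \<and>
      (\<lambda>n. \<phi> \<omega> (\<tau> n)) \<longlonglongrightarrow> v" by blast
  next
    assume "\<exists>\<tau>. (\<forall>n. 0 \<le> \<tau> n) \<and> filterlim \<tau> at_top sequentially \<and> (\<lambda>n. \<phi> \<omega> (\<tau> n)) \<longlonglongrightarrow> v"
    then obtain \<tau> where \<tau>: "filterlim \<tau> at_top sequentially" "(\<lambda>n. \<phi> \<omega> (\<tau> n)) \<longlonglongrightarrow> v"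
      by blast
    have "v \<in> closure (\<phi> \<omega> ` {real m..})" for m
    proof (rule Lim_in_closed_set[OF closed_closure _ _ \<tau>(2)])
      have "\<forall>\<^sub>F n in sequentially. real m \<le> \<tau> n"
        using \<tau>(1) by (simp add: filterlim_at_top)
      then show "\<forall>\<^sub>F n in sequentially. \<phi> \<omega> (\<tau> n) \<in> closure (\<phi> \<omega> ` {real m..})"
        by eventually_elim (use closure_subset in fastforce)
    qed simp
    then show "v \<in> M" by (simp add: M_def)
  qed
  have "closure (\<phi> \<omega> ` {real n..}) \<subseteq> \<Omega>" for n
    using in_\<Omega> w(1) \<Omega> by (intro closure_minimal compact_imp_closed) auto
  then have sub: "M \<subseteq> \<Omega>"
    by (auto simp: M_def)
  have shift: "\<phi> v s \<in> M" if v: "v \<in> M" for v s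
  proof -
    obtain \<tau> where \<tau>: "filterlim \<tau> at_top sequentially" "(\<lambda>n. \<phi> \<omega> (\<tau> n)) \<longlonglongrightarrow> v"
      using v M_iff by blast
    \<comment> \<open>For negative \<open>s\<close> the time \<open>\<tau> n + s\<close> may be
      negative. Cutting it off at \<open>0\<close> changes only finitely many terms, hence no
      limit.\<close>
    define \<sigma> where "\<sigma> n = max 0 (\<tau> n + s)" for n
    have \<tau>s: "filterlim (\<lambda>n. \<tau> n + s) at_top sequentially"
      using filterlim_tendsto_add_at_top[OF tendsto_const \<tau>(1), of s] by (simp add: add.commute)
    then have \<sigma>: "filterlim \<sigma> at_top sequentially"
      by (rule filterlim_at_top_mono) (simp add: \<sigma>_def)
    have "(\<lambda>n. \<phi> (\<phi> \<omega> (\<tau> n)) s) \<longlonglongrightarrow> \<phi> v s"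
      using continuous_on_tendsto_compose[OF cont \<tau>(2)] v sub in_\<Omega> w(1) by auto
    moreover have "\<forall>\<^sub>F n in sequentially. \<phi> (\<phi> \<omega> (\<tau> n)) s = \<phi> \<omega> (\<sigma> n)"
      using \<tau>s[unfolded filterlim_at_top, rule_format, of 0]
      by eventually_elim (simp add: \<sigma>_def add[OF w(1)])
    ultimately have "(\<lambda>n. \<phi> \<omega> (\<sigma> n)) \<longlonglongrightarrow> \<phi> v s"
      using tendsto_cong by fast
    moreover have "\<forall>n. 0 \<le> \<sigma> n"
      by (simp add: \<sigma>_def)
    ultimately show ?thesis
      using \<sigma> M_iff by blast
  qed
  have "(\<lambda>v. \<phi> v t) ` M = M" for t
  proof
    show "M \<subseteq> (\<lambda>v. \<phi> v t) ` M"
    proof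
      fix v assume v: "v \<in> M"
      then have "v = \<phi> (\<phi> v (- t)) t"
        using add[of v "- t" t] zero sub by auto
      then show "v \<in> (\<lambda>v. \<phi> v t) ` M"
        using shift[OF v] by blast
    qed
  qed (use shift in auto)
  moreover have "M \<noteq> {}"
  proof -
    obtain l r where lr: "strict_mono r" "((\<lambda>n. \<phi> \<omega> (real n)) \<circ> r) \<longlonglongrightarrow> l"
      using \<Omega> in_\<Omega>[OF w(1)] unfolding compact_def by metis
    have "filterlim (\<lambda>n. real (r n)) at_top sequentially"
      using filterlim_compose[OF filterlim_real_sequentially filterlim_subseq[OF lr(1)]] .
    then have "l \<in> M"
      using lr(2) unfolding M_iff by (intro exI[of _ "\<lambda>n. real (r n)"]) (auto simp: o_def)
    then show ?thesis by blast
  qed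
  moreover have "compact M"
  proof -
    have "closed M"
      unfolding M_def by (intro closed_INT) auto
    then show ?thesis
      using \<Omega> sub by (metis closed_Int_compact inf.absorb1)
  qed
  ultimately have "M = \<Omega>"
    using min sub unfolding minimal_flow_def by blast
  then show thesis
    using M_iff[of w] w(2) that by blast
qed

text \<open>This is the part of the setting that does not mention the order. The arguments made here
  can therefore serve both for orbits below and for orbits above a translate of
  \<open>K\<close>.\<close>

locale stable_graph =
  fixes X :: "'v::banach set" and \<Omega> :: "'w::metric_space set"
    and \<phi> :: "'w \<Rightarrow> real \<Rightarrow> 'w" and u :: "real \<Rightarrow> 'v \<Rightarrow> 'w \<Rightarrow> 'v"
    and act :: "'g::{metric_space, topological_group_add} \<Rightarrow> 'v \<Rightarrow> 'v" and b :: "'w \<Rightarrow> 'v"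
  assumes closed_X: "closed X"
    and compact_base: "compact \<Omega>" and flow: "continuous_flow \<Omega> \<phi>"
    and minimal: "minimal_flow \<Omega> \<phi>"
    and semiflow: "skew_product_semiflow X \<Omega> u \<phi>"
    and action: "continuous_action X act" and commutes: "commutes_with_semiflow X \<Omega> u act"
    and b_in: "\<And>\<omega>. \<omega> \<in> \<Omega> \<Longrightarrow> b \<omega> \<in> X"
    and b_cont: "continuous_on \<Omega> b"
    and b_inv: "\<And>\<omega> t. \<omega> \<in> \<Omega> \<Longrightarrow> 0 \<le> t \<Longrightarrow> u t (b \<omega>) \<omega> = b (\<phi> \<omega> t)"
    and stable: "uniformly_stable X u (graph_over \<Omega> b)"
begin

lemma flow_in: "\<omega> \<in> \<Omega> \<Longrightarrow> \<phi> \<omega> t \<in> \<Omega>"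
  using flow by (auto simp: continuous_flow_def)

lemma flow_add: "\<omega> \<in> \<Omega> \<Longrightarrow> \<phi> \<omega> (s + t) = \<phi> (\<phi> \<omega> s) t"
  using flow by (auto simp: continuous_flow_def)

lemma u_in: "x \<in> X \<Longrightarrow> \<omega> \<in> \<Omega> \<Longrightarrow> 0 \<le> t \<Longrightarrow> u t x \<omega> \<in> X"
  using semiflow by (auto simp: skew_product_semiflow_def)

lemma u_add: "x \<in> X \<Longrightarrow> \<omega> \<in> \<Omega> \<Longrightarrow> 0 \<le> s \<Longrightarrow> 0 \<le> t \<Longrightarrow> u (t + s) x \<omega> = u s (u t x \<omega>) (\<phi> \<omega> t)"
  using semiflow by (auto simp: skew_product_semiflow_def)

lemma act_in: "x \<in> X \<Longrightarrow> act g x \<in> X"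
  using action by (auto simp: continuous_action_def)

lemma act_zero: "x \<in> X \<Longrightarrow> act 0 x = x"
  using action by (auto simp: continuous_action_def)

lemma act_minus_cancel: "x \<in> X \<Longrightarrow> act g (act (- g) x) = x" "x \<in> X \<Longrightarrow> act (- g) (act g x) = x"
  using action unfolding continuous_action_def
  by (metis add.right_inverse, metis add.left_inverse)

lemma act_tendsto:
  assumes "(s \<longlongrightarrow> g) F" "(y \<longlongrightarrow> x) F" "\<forall>\<^sub>F n in F. y n \<in> X" "x \<in> X"
  shows "((\<lambda>n. act (s n) (y n)) \<longlongrightarrow> act g x) F"
proof -
  have "continuous_on (UNIV \<times> X) (\<lambda>(g, x). act g x)"
    using action by (simp add: continuous_action_def)
  from continuous_on_tendsto_compose[OF this tendsto_Pair[OF assms(1,2)]] assms(3,4)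
  show ?thesis by simp
qed

lemma act_continuous: "continuous_on X (act g)"
  unfolding continuous_on_def
  by (intro ballI act_tendsto tendsto_const tendsto_ident_at) (auto simp: eventually_at_filter)

lemma act_b_tendsto:
  assumes "((\<lambda>n. w n) \<longlongrightarrow> \<omega>) F" "\<forall>\<^sub>F n in F. w n \<in> \<Omega>" "\<omega> \<in> \<Omega>"
  shows "((\<lambda>n. act g (b (w n))) \<longlongrightarrow> act g (b \<omega>)) F"
  using assms by (intro act_tendsto tendsto_const continuous_on_tendsto_compose[OF b_cont])
    (auto intro: b_in elim: eventually_mono)

lemma u_act_b: "\<omega> \<in> \<Omega> \<Longrightarrow> 0 \<le> t \<Longrightarrow> u t (act g (b \<omega>)) \<omega> = act g (b (\<phi> \<omega> t))"
  using commutes b_in b_inv unfolding commutes_with_semiflow_def by metis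

lemma translate_graph: "translate act g (graph_over \<Omega> b) = {(act g (b \<omega>), \<omega>) | \<omega>. \<omega> \<in> \<Omega>}"
  by (auto simp: translate_def graph_over_def image_iff)

text \<open>Since \<open>g\<close> commutes with the semiflow, \<open>u t y\<close> is
  \<open>g\<close> applied to the orbit of \<open>(- g) y\<close>. So one pulls back by
  \<open>- g\<close>, uses stability of the original graph, and pushes forward by \<open>g\<close>.
  The action need not be isometric, but it is uniformly continuous near the compact images
  involved.\<close>

lemma stable_translate:
  assumes "\<epsilon> > 0"
  obtains d where "d > 0" "\<And>\<omega> y t. \<omega> \<in> \<Omega> \<Longrightarrow> y \<in> X \<Longrightarrow> norm (y - act g (b \<omega>)) < d \<Longrightarrow> 0 \<le> t \<Longrightarrow>
    norm (u t y \<omega> - act g (b (\<phi> \<omega> t))) < \<epsilon>"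
proof -
  have cb: "compact (b ` \<Omega>)"
    by (intro compact_continuous_image b_cont compact_base)
  \<comment> \<open>The radii are chosen backwards: \<open>d1\<close> for pushing forward by
    \<open>g\<close>, \<open>d2\<close> for stability, \<open>d\<close> for pulling back by
    \<open>- g\<close>.\<close>
  obtain d1 where d1: "d1 > 0" "\<And>c y. c \<in> b ` \<Omega> \<Longrightarrow> y \<in> X \<Longrightarrow> dist c y < d1 \<Longrightarrow> dist (act g c) (act g y) < \<epsilon>"
    using uniform_continuity_near_compact[OF act_continuous cb _ assms] b_in by blast
  obtain d2 where d2: "d2 > 0" "\<And>\<omega> y t. \<omega> \<in> \<Omega> \<Longrightarrow> y \<in> X \<Longrightarrow> norm (b \<omega> - y) \<le> d2 \<Longrightarrow> 0 \<le> t \<Longrightarrow>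
      norm (u t (b \<omega>) \<omega> - u t y \<omega>) < d1"
    using stable d1(1) unfolding uniformly_stable_def graph_over_def by fast
  obtain d where d: "d > 0" "\<And>c y. c \<in> act g ` b ` \<Omega> \<Longrightarrow> y \<in> X \<Longrightarrow> dist c y < d \<Longrightarrow>
      dist (act (- g) c) (act (- g) y) < d2"
  proof (rule uniform_continuity_near_compact[OF act_continuous _ _ d2(1)])
    show "compact (act g ` b ` \<Omega>)"
      using b_in by (intro compact_continuous_image cb continuous_on_subset[OF act_continuous]) auto
    show "act g ` b ` \<Omega> \<subseteq> X"
      using b_in act_in by auto
  qed auto
  show thesis
  proof
    fix \<omega> y t assume a: "\<omega> \<in> \<Omega>" "y \<in> X" "norm (y - act g (b \<omega>)) < d" "0 \<le> (t::real)"
    have "dist (act (- g) (act g (b \<omega>))) (act (- g) y) < d2"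
      using a by (intro d(2)) (auto simp: dist_norm norm_minus_commute)
    then have "norm (u t (b \<omega>) \<omega> - u t (act (- g) y) \<omega>) < d1"
      using a by (intro d2(2)) (auto simp: dist_norm act_minus_cancel b_in act_in)
    then have "dist (act g (b (\<phi> \<omega> t))) (act g (u t (act (- g) y) \<omega>)) < \<epsilon>"
      using a by (intro d1(2)) (auto simp: dist_norm b_inv flow_in u_in act_in)
    moreover have "act g (u t (act (- g) y) \<omega>) = u t y \<omega>"
      using a commutes unfolding commutes_with_semiflow_def by (simp add: act_in act_minus_cancel)
    ultimately show "norm (u t y \<omega> - act g (b (\<phi> \<omega> t))) < \<epsilon>"
      by (simp add: dist_norm norm_minus_commute)
  qed (rule d(1))
qed

lemma omega_limitE:
  assumes "(y, w) \<in> omega_limit u \<phi> (x, \<omega>)"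
  obtains \<tau> :: "nat \<Rightarrow> real" where "\<And>n. 0 \<le> \<tau> n" "filterlim \<tau> at_top sequentially"
    "(\<lambda>n. u (\<tau> n) x \<omega>) \<longlonglongrightarrow> y" "(\<lambda>n. \<phi> \<omega> (\<tau> n)) \<longlonglongrightarrow> w"
proof -
  obtain \<tau> where \<tau>: "\<And>n. 0 \<le> \<tau> n" "filterlim \<tau> at_top sequentially"
    and lim: "(\<lambda>n. (u (\<tau> n) x \<omega>, \<phi> \<omega> (\<tau> n))) \<longlonglongrightarrow> (y, w)"
    using assms by (auto simp: omega_limit_def skew_map_def)
  show thesis
    using that[OF \<tau>] tendsto_fst[OF lim] tendsto_snd[OF lim] by simp
qed

lemma omega_limit_subset:
  assumes "x \<in> X" "\<omega> \<in> \<Omega>" "(y, w) \<in> omega_limit u \<phi> (x, \<omega>)"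
  shows "y \<in> X" "w \<in> \<Omega>"
proof -
  obtain \<tau> where \<tau>: "\<And>n. 0 \<le> \<tau> n" "(\<lambda>n. u (\<tau> n) x \<omega>) \<longlonglongrightarrow> y" "(\<lambda>n. \<phi> \<omega> (\<tau> n)) \<longlonglongrightarrow> w"
    using omega_limitE[OF assms(3)] by blast
  show "y \<in> X"
    using closed_sequentially[OF closed_X _ \<tau>(2)] u_in assms \<tau>(1) by blast
  show "w \<in> \<Omega>"
    using closed_sequentially[OF compact_imp_closed[OF compact_base] _ \<tau>(3)] flow_in assms by blast
qed

text \<open>Relative compactness lets times be thinned until the orbit converges too. The times are
  prescribed by the caller, so two orbits can be compared along common times.\<close>

lemma omega_limit_subseq:
  assumes "compact (closure (forward_orbit u \<phi> (x, \<omega>)))"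
    and \<tau>: "\<And>n. 0 \<le> \<tau> n" "filterlim \<tau> at_top sequentially"
    and w: "(\<lambda>n. \<phi> \<omega> (\<tau> n)) \<longlonglongrightarrow> w"
  obtains r y where "strict_mono r" "(\<lambda>n. u (\<tau> (r n)) x \<omega>) \<longlonglongrightarrow> y" "(y, w) \<in> omega_limit u \<phi> (x, \<omega>)"
proof -
  have "skew_map u \<phi> (\<tau> n) (x, \<omega>) \<in> closure (forward_orbit u \<phi> (x, \<omega>))" for n
    using \<tau>(1) by (intro subsetD[OF closure_subset]) (auto simp: forward_orbit_def)
  then obtain l r where r: "strict_mono r" and l: "((\<lambda>n. skew_map u \<phi> (\<tau> n) (x, \<omega>)) \<circ> r) \<longlonglongrightarrow> l"
    using assms(1) unfolding compact_def by metis
  have "(\<lambda>n. u (\<tau> (r n)) x \<omega>) \<longlonglongrightarrow> fst l" "(\<lambda>n. \<phi> \<omega> (\<tau> (r n))) \<longlonglongrightarrow> snd l"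
    using tendsto_fst[OF l] tendsto_snd[OF l] by (simp_all add: o_def skew_map_def)
  moreover from this(2) have "snd l = w"
    using LIMSEQ_subseq_LIMSEQ[OF w r] LIMSEQ_unique by (fastforce simp: o_def)
  moreover have "filterlim (\<lambda>n. \<tau> (r n)) at_top sequentially"
    using filterlim_compose[OF \<tau>(2) filterlim_subseq[OF r]] .
  then have "l \<in> omega_limit u \<phi> (x, \<omega>)"
    using \<tau>(1) l unfolding omega_limit_def by (intro CollectI exI[of _ "\<lambda>n. \<tau> (r n)"]) (auto simp: o_def)
  ultimately show thesis
    using that[OF r] by (metis prod.collapse)
qed

text \<open>The base orbit returns near \<open>w\<close> at arbitrarily late times, and the orbit
  subconverges along these times.\<close>

lemma omega_limit_fibre:
  assumes "compact (closure (forward_orbit u \<phi> (x, \<omega>)))" "\<omega> \<in> \<Omega>" "w \<in> \<Omega>"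
  obtains y where "(y, w) \<in> omega_limit u \<phi> (x, \<omega>)"
  using dense_forward_orbit[OF compact_base flow minimal assms(2,3)]
    omega_limit_subseq[OF assms(1)] by metis

lemma omega_limit_norm_le:
  assumes \<omega>: "\<omega> \<in> \<Omega>" and yw: "(y, w) \<in> omega_limit u \<phi> (x, \<omega>)" and w: "w \<in> \<Omega>"
    and T: "\<And>t. T \<le> t \<Longrightarrow> norm (u t x \<omega> - act g (b (\<phi> \<omega> t))) \<le> \<epsilon>"
  shows "norm (y - act g (b w)) \<le> \<epsilon>"
proof -
  obtain \<tau> where \<tau>: "filterlim \<tau> at_top sequentially"
    "(\<lambda>n. u (\<tau> n) x \<omega>) \<longlonglongrightarrow> y" "(\<lambda>n. \<phi> \<omega> (\<tau> n)) \<longlonglongrightarrow> w"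
    using omega_limitE[OF yw] by blast
  have "(\<lambda>n. norm (u (\<tau> n) x \<omega> - act g (b (\<phi> \<omega> (\<tau> n))))) \<longlonglongrightarrow> norm (y - act g (b w))"
    using \<tau> \<omega> w by (intro tendsto_norm tendsto_diff act_b_tendsto) (auto simp: flow_in)
  moreover have "\<forall>\<^sub>F n in sequentially. norm (u (\<tau> n) x \<omega> - act g (b (\<phi> \<omega> (\<tau> n)))) \<le> \<epsilon>"
    using \<tau>(1)[unfolded filterlim_at_top, rule_format, of T] by eventually_elim (rule T)
  ultimately show ?thesis
    by (rule tendsto_upperbound) simp
qed

text \<open>Touching means that at some time the orbit is as close to \<open>gK\<close> as desired;
  stability of \<open>gK\<close> then keeps it close for all later times. As the tolerance is
  arbitrary, the orbit converges to \<open>gK\<close>.\<close>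

lemma touching_translate:
  assumes "compact (closure (forward_orbit u \<phi> (x, \<omega>)))" and x: "x \<in> X" and \<omega>: "\<omega> \<in> \<Omega>"
    and touch: "(act g (b w), w) \<in> omega_limit u \<phi> (x, \<omega>)"
  shows "omega_limit u \<phi> (x, \<omega>) = translate act g (graph_over \<Omega> b)"
    and "((\<lambda>t. norm (u t x \<omega> - act g (b (\<phi> \<omega> t)))) \<longlongrightarrow> 0) at_top"
proof -
  have w: "w \<in> \<Omega>"
    using omega_limit_subset(2)[OF x \<omega> touch] .
  obtain \<tau> where \<tau>: "\<And>n. 0 \<le> \<tau> n"
    "(\<lambda>n. u (\<tau> n) x \<omega>) \<longlonglongrightarrow> act g (b w)" "(\<lambda>n. \<phi> \<omega> (\<tau> n)) \<longlonglongrightarrow> w"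
    using omega_limitE[OF touch] by blast
  have lim: "(\<lambda>n. norm (u (\<tau> n) x \<omega> - act g (b (\<phi> \<omega> (\<tau> n))))) \<longlonglongrightarrow> 0"
    using tendsto_norm[OF tendsto_diff[OF \<tau>(2) act_b_tendsto[OF \<tau>(3) _ w, of g]]] flow_in[OF \<omega>] by simp
  have near: "\<exists>T. \<forall>t\<ge>T. norm (u t x \<omega> - act g (b (\<phi> \<omega> t))) < \<epsilon>" if \<epsilon>: "\<epsilon> > 0" for \<epsilon>
  proof -
    obtain d where d: "d > 0" "\<And>\<omega> y t. \<omega> \<in> \<Omega> \<Longrightarrow> y \<in> X \<Longrightarrow> norm (y - act g (b \<omega>)) < d \<Longrightarrow> 0 \<le> t \<Longrightarrow>
        norm (u t y \<omega> - act g (b (\<phi> \<omega> t))) < \<epsilon>"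
      using stable_translate[OF \<epsilon>] by blast
    obtain n where n: "norm (u (\<tau> n) x \<omega> - act g (b (\<phi> \<omega> (\<tau> n)))) < d"
      using order_tendstoD(2)[OF lim d(1)] by (auto simp: eventually_sequentially)
    have "norm (u t x \<omega> - act g (b (\<phi> \<omega> t))) < \<epsilon>" if "t \<ge> \<tau> n" for t
      using d(2)[OF flow_in[OF \<omega>] u_in[OF x \<omega> \<tau>(1)] n, of "t - \<tau> n"] that
      by (simp add: u_add[OF x \<omega> _ \<tau>(1), symmetric] flow_add[OF \<omega>, symmetric])
    then show ?thesis by blast
  qed
  then show "((\<lambda>t. norm (u t x \<omega> - act g (b (\<phi> \<omega> t)))) \<longlongrightarrow> 0) at_top"
    by (auto simp: tendsto_iff eventually_at_top_linorder)
  have on_graph: "y = act g (b w')" if yw: "(y, w') \<in> omega_limit u \<phi> (x, \<omega>)" for y w'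
  proof -
    have "norm (y - act g (b w')) \<le> \<epsilon>" if "\<epsilon> > 0" for \<epsilon>
      using near[OF that] omega_limit_norm_le[OF \<omega> yw omega_limit_subset(2)[OF x \<omega> yw]] less_imp_le
      by metis
    then show ?thesis
      using field_le_epsilon[of "norm (y - act g (b w'))" 0] by simp
  qed
  show "omega_limit u \<phi> (x, \<omega>) = translate act g (graph_over \<Omega> b)"
    unfolding translate_graph
  proof (intro equalityI subrelI)
    fix y w' assume "(y, w') \<in> omega_limit u \<phi> (x, \<omega>)"
    then show "(y, w') \<in> {(act g (b \<omega>), \<omega>) | \<omega>. \<omega> \<in> \<Omega>}"
      using on_graph omega_limit_subset(2)[OF x \<omega>] by simp
  next
    fix y w' assume "(y, w') \<in> {(act g (b \<omega>), \<omega>) | \<omega>. \<omega> \<in> \<Omega>}"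
    \<comment> \<open>The limit set has a point over every \<open>w'\<close>, and
      \<open>on_graph\<close> leaves only the point of \<open>gK\<close> for it.\<close>
    then have "w' \<in> \<Omega>" "y = act g (b w')"
      by auto
    then show "(y, w') \<in> omega_limit u \<phi> (x, \<omega>)"
      using omega_limit_fibre[OF assms(1) \<omega>] on_graph by metis
  qed
qed

section \<open>Capture of omega-limit sets\<close>

text \<open>The relation \<open>R\<close> stands for \<open>\<le>\<close> and for \<open>\<ge>\<close>.\<close>

lemma capture:
  assumes conn: "connected (UNIV :: 'g set)"
    and R: "closed {p. R (fst p) (snd p)}"
    and x: "x \<in> X" "\<omega> \<in> \<Omega>" and cpt: "compact (closure (forward_orbit u \<phi> (x, \<omega>)))"
    and h: "\<And>y w. (y, w) \<in> omega_limit u \<phi> (x, \<omega>) \<Longrightarrow> R (act h (b w)) y"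
    and nbhd: "\<And>h. (\<And>y w. (y, w) \<in> omega_limit u \<phi> (x, \<omega>) \<Longrightarrow> R (act h (b w)) y \<and> act h (b w) \<noteq> y) \<Longrightarrow>
      \<exists>B. open B \<and> 0 \<in> B \<and> (\<forall>g\<in>B. \<forall>(y, w)\<in>omega_limit u \<phi> (x, \<omega>).
        R (act (g + h) (b w)) y \<and> act (g + h) (b w) \<noteq> y)"
    and k: "(y0, w0) \<in> omega_limit u \<phi> (x, \<omega>)" "\<not> R (act k (b w0)) y0"
  obtains g where "omega_limit u \<phi> (x, \<omega>) = translate act g (graph_over \<Omega> b)"
    "((\<lambda>t. norm (u t x \<omega> - act g (b (\<phi> \<omega> t)))) \<longlongrightarrow> 0) at_top"
proof -
  define L where "L = omega_limit u \<phi> (x, \<omega>)"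
  \<comment> \<open>\<open>S\<close> collects the translates lying strictly on the far side of the
    limit set. An element \<open>g\<close> outside \<open>S\<close> that still satisfies the weak
    relation everywhere must give equality somewhere, that is, contact with
    \<open>gK\<close>.\<close>
  define S where "S = {h. \<forall>(y, w)\<in>L. R (act h (b w)) y \<and> act h (b w) \<noteq> y}"
  have "\<exists>g. (\<forall>(y, w)\<in>L. R (act g (b w)) y) \<and> g \<notin> S"
  proof (cases "h \<in> S")
    case False
    then show ?thesis using h by (auto simp: L_def)
  next
    case True
    have "\<exists>B. open B \<and> 0 \<in> B \<and> (\<forall>g\<in>B. g + h \<in> S)" if "h \<in> S" for h
      using nbhd[of h] that by (auto simp: S_def L_def)
    moreover have "k \<notin> S"
      using k by (auto simp: S_def L_def)
    ultimately obtain s g where s: "\<And>n. s n \<in> S" "s \<longlonglongrightarrow> g" "g \<notin> S"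
      using connected_group_boundary[OF conn True] by blast
    \<comment> \<open>The boundary point \<open>g\<close> is a limit of elements of
      \<open>S\<close>, and the weak relation survives the limit because \<open>R\<close> is
      closed.\<close>
    have "R (act g (b w)) y" if yw: "(y, w) \<in> L" for y w
    proof -
      have "b w \<in> X"
        using yw x omega_limit_subset(2) b_in by (auto simp: L_def)
      then have "(\<lambda>n. (act (s n) (b w), y)) \<longlonglongrightarrow> (act g (b w), y)"
        by (intro tendsto_Pair act_tendsto s tendsto_const) auto
      from closed_sequentially[OF R _ this] show ?thesis
        using s(1) yw by (auto simp: S_def)
    qed
    then show ?thesis using s(3) by blast
  qed
  then obtain g y w where "(y, w) \<in> L" "act g (b w) = y"
    by (auto simp: S_def)
  then show thesis
    using that touching_translate[OF cpt x] by (metis L_def)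
qed

end

section \<open>Closed orders and graphs\<close>

lemma closed_le_relation:
  assumes "closed {v::'v::{real_normed_vector, ordered_real_vector}. 0 \<le> v}"
  shows "closed {p::'v \<times> 'v. fst p \<le> snd p}" "closed {p::'v \<times> 'v. snd p \<le> fst p}"
proof -
  have "closed ((\<lambda>p::'v \<times> 'v. snd p - fst p) -` {v. 0 \<le> v})"
    "closed ((\<lambda>p::'v \<times> 'v. fst p - snd p) -` {v. 0 \<le> v})"
    by (intro closed_vimage assms continuous_intros)+
  then show "closed {p::'v \<times> 'v. fst p \<le> snd p}" "closed {p::'v \<times> 'v. snd p \<le> fst p}"
    by (simp_all add: vimage_def)
qed

lemma meet_in_eqI:
  assumes "glb_in X u v w"
  shows "meet_in X u v = w"
  unfolding meet_in_def
proof (rule the_equality, rule assms)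
  fix z assume "glb_in X u v z"
  then show "z = w"
    using assms unfolding glb_in_def by (metis order.antisym)
qed

text \<open>The projection of a compact graph to the base is a continuous bijection onto a Hausdorff
  space, so its inverse is continuous, and \<open>b\<close> is the first component of that
  inverse.\<close>

lemma graph_continuous:
  fixes b :: "'w::t2_space \<Rightarrow> 'v::t2_space"
  assumes "compact (graph_over \<Omega> b)"
  shows "continuous_on \<Omega> b"
proof -
  have "continuous_on (snd ` graph_over \<Omega> b) (\<lambda>\<omega>. (b \<omega>, \<omega>))"
    by (rule continuous_on_inv[where f = snd, OF _ assms]) (auto simp: graph_over_def intro: continuous_intros)
  moreover have "snd ` graph_over \<Omega> b = \<Omega>"
    by (auto simp: graph_over_def image_iff)
  ultimately show ?thesis
    using continuous_on_fst by fastforce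
qed

text \<open>A graph has a single point over each base point, so the first half of
  \<open>sets_less\<close> becomes a pointwise relation on \<open>L\<close> (for the reversed order,
  the second half). The remaining half then follows since \<open>L\<close> has a point in every
  fibre. Strictness is split into a weak relation and \<open>\<noteq>\<close> to match
  \<open>capture\<close>.\<close>

lemma sets_less_graph_iff:
  assumes L: "\<And>y w. (y, w) \<in> L \<Longrightarrow> w \<in> \<Omega>" and fibre: "\<And>w. w \<in> \<Omega> \<Longrightarrow> \<exists>y. (y, w) \<in> L"
  shows "sets_less L {(c w, w) | w. w \<in> \<Omega>} \<longleftrightarrow> (\<forall>(y, w)\<in>L. y \<le> c w \<and> c w \<noteq> y)" (is ?less)
    and "sets_less {(c w, w) | w. w \<in> \<Omega>} L \<longleftrightarrow> (\<forall>(y, w)\<in>L. c w \<le> y \<and> c w \<noteq> y)" (is ?greater)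
proof -
  have on_L: "(\<forall>(y, w)\<in>L. \<exists>z. (z, w) \<in> {(c w, w) | w. w \<in> \<Omega>} \<and> P y z) \<longleftrightarrow> (\<forall>(y, w)\<in>L. P y (c w))" for P
    by (intro ball_cong refl) (use L in \<open>auto split: prod.split\<close>)
  have on_graph: "\<forall>(z, w)\<in>{(c w, w) | w. w \<in> \<Omega>}. \<exists>y. (y, w) \<in> L \<and> P y z" if P: "\<forall>(y, w)\<in>L. P y (c w)" for P
  proof clarify
    fix w assume "w \<in> \<Omega>"
    then obtain y where "(y, w) \<in> L"
      using fibre by blast
    then show "\<exists>y. (y, w) \<in> L \<and> P y (c w)"
      using P by auto
  qed
  have less: "a < d \<longleftrightarrow> a \<le> d \<and> d \<noteq> a" "a < d \<longleftrightarrow> a \<le> d \<and> a \<noteq> d" for a d :: 'a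
    by auto
  show ?less
    unfolding sets_less_def less(1) on_L
    by (intro iffI conjI; (elim conjunct1 on_graph)?)
  show ?greater
    unfolding sets_less_def less(2) on_L[of "\<lambda>y z. z \<le> y \<and> z \<noteq> y"]
    by (intro iffI conjI; (elim conjunct2 on_graph[of "\<lambda>y z. z \<le> y \<and> z \<noteq> y"])?)
qed

theorem theoremD:
  fixes X :: "'v::{banach, ordered_real_vector} set"
    and \<Omega> :: "'w::metric_space set"
    and \<phi> :: "'w \<Rightarrow> real \<Rightarrow> 'w"
    and u :: "real \<Rightarrow> 'v \<Rightarrow> 'w \<Rightarrow> 'v"
    and act :: "'g::{metric_space, topological_group_add} \<Rightarrow> 'v \<Rightarrow> 'v"
    and ub :: "'w \<Rightarrow> 'v"
    and K :: "('v \<times> 'w) set"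
    and \<delta> :: real
  assumes "closed {v::'v. 0 \<le> v}"
    and "closed X" and "order_convex X" and "has_continuous_meets X"
    and "compact \<Omega>" and "continuous_flow \<Omega> \<phi>" and "minimal_flow \<Omega> \<phi>"
    and "skew_product_semiflow X \<Omega> u \<phi>" and "monotone_semiflow X \<Omega> u"
    and "connected (UNIV :: 'g set)" and "locally compact (UNIV :: 'g set)"
    and "continuous_action X act" and "order_preserving_action X act"
    and "commutes_with_semiflow X \<Omega> u act"
    and "K = graph_over \<Omega> ub"
    and "one_cover X \<Omega> u \<phi> K" and "minimal_set u \<phi> K" and "uniformly_stable X u K"
    and "\<delta> > 0"
    and "\<And>p. p \<in> tube X \<Omega> ub \<delta> \<Longrightarrow> compact (closure (forward_orbit u \<phi> p))"
    and "\<And>p h. p \<in> tube X \<Omega> ub \<delta> \<Longrightarrow> omega_limit u \<phi> p \<subseteq> tube X \<Omega> ub \<delta> \<Longrightarrow>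
           sets_less (omega_limit u \<phi> p) (translate act h K) \<Longrightarrow>
           \<exists>B. open B \<and> 0 \<in> B \<and>
             (\<forall>g\<in>B. sets_less (omega_limit u \<phi> p) (translate act (g + h) K))"
    and "\<And>p h. p \<in> tube X \<Omega> ub \<delta> \<Longrightarrow> omega_limit u \<phi> p \<subseteq> tube X \<Omega> ub \<delta> \<Longrightarrow>
           sets_less (translate act h K) (omega_limit u \<phi> p) \<Longrightarrow>
           \<exists>B. open B \<and> 0 \<in> B \<and>
             (\<forall>g\<in>B. sets_less (translate act (g + h) K) (omega_limit u \<phi> p))"
    and "group_orbit act K \<noteq> K"
  shows "\<exists>\<delta>'. 0 < \<delta>' \<and> \<delta>' < \<delta> \<and>
           (\<forall>x \<omega>. (x, \<omega>) \<in> tube X \<Omega> ub \<delta>' \<longrightarrow>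
             (\<exists>h. omega_limit u \<phi> (x, \<omega>) = translate act h K \<and>
                  ((\<lambda>t. norm (u t x \<omega> - act h (ub (\<phi> \<omega> t)))) \<longlongrightarrow> 0) at_top))"
proof -
  note [simp] = assms(15)
  have cone: "closed {p::'v \<times> 'v. fst p \<le> snd p}" "closed {p::'v \<times> 'v. snd p \<le> fst p}"
    using closed_le_relation[OF assms(1)] .
  have Kinv: "positively_invariant u \<phi> K" and "compact K" and KX: "K \<subseteq> X \<times> \<Omega>"
    using assms(16) by (auto simp: one_cover_def)
  have ub_in: "ub \<omega> \<in> X" if "\<omega> \<in> \<Omega>" for \<omega>
    using KX that by (auto simp: graph_over_def)
  have ub_inv: "u t (ub \<omega>) \<omega> = ub (\<phi> \<omega> t)" if "\<omega> \<in> \<Omega>" "0 \<le> t" for \<omega> t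
  proof -
    have "(ub \<omega>, \<omega>) \<in> K"
      using that by (auto simp: graph_over_def)
    then have "skew_map u \<phi> t (ub \<omega>, \<omega>) \<in> K"
      using Kinv that(2) unfolding positively_invariant_def by blast
    then show ?thesis
      by (auto simp: skew_map_def graph_over_def)
  qed
  interpret stable_graph X \<Omega> \<phi> u act ub
    using assms graph_continuous[of \<Omega> ub] \<open>compact K\<close> ub_in ub_inv
    by unfold_locales auto
  have mono: "u t x \<omega> \<le> u t y \<omega>" if "0 \<le> t" "\<omega> \<in> \<Omega>" "x \<in> X" "y \<in> X" "x \<le> y" for t x y \<omega>
    using assms(9) that by (auto simp: monotone_semiflow_def)

  \<comment> \<open>Translates of \<open>K\<close> that fail to be comparable with
    \<open>K\<close>\<close>
  obtain g w0 where g: "w0 \<in> \<Omega>" "act g (ub w0) \<noteq> ub w0"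
  proof (rule ccontr)
    assume "\<not> thesis"
    then have "\<forall>\<omega>\<in>\<Omega>. act g (ub \<omega>) = ub \<omega>" for g
      using that by blast
    then have "translate act g K = K" for g
      unfolding assms(15) translate_graph by (fastforce simp: graph_over_def)
    then show False
      using assms(23) by (simp add: group_orbit_def)
  qed
  \<comment> \<open>If \<open>ub w0\<close> were below all its translates, then it would be below
    those by \<open>g\<close> and by \<open>- g\<close>; applying \<open>g\<close> to the latter
    inequality gives the reverse of the former, so \<open>g\<close> would fix \<open>ub w0\<close>.
    The next claim is dual.\<close>
  have "\<exists>k. \<not> ub w0 \<le> act k (ub w0)"
  proof (rule ccontr)
    assume "\<nexists>k. \<not> ub w0 \<le> act k (ub w0)"
    then have "ub w0 \<le> act g (ub w0)" "act g (ub w0) \<le> act g (act (- g) (ub w0))"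
      using assms(13) ub_in[OF g(1)] act_in unfolding order_preserving_action_def by auto
    then show False
      using g ub_in act_minus_cancel by auto
  qed
  then obtain k1 where k1: "\<not> ub w0 \<le> act k1 (ub w0)" by blast
  have "\<exists>k. \<not> act k (ub w0) \<le> ub w0"
  proof (rule ccontr)
    assume "\<nexists>k. \<not> act k (ub w0) \<le> ub w0"
    then have "act g (ub w0) \<le> ub w0" "act g (act (- g) (ub w0)) \<le> act g (ub w0)"
      using assms(13) ub_in[OF g(1)] act_in unfolding order_preserving_action_def by auto
    then show False
      using g ub_in act_minus_cancel by auto
  qed
  then obtain k2 where k2: "\<not> act k2 (ub w0) \<le> ub w0" by blast

  \<comment> \<open>Closedness of the order makes the two failures of comparability persist near
    \<open>ub w0\<close>. Limit points over \<open>w0\<close> that lie in \<open>U\<close> will thus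
    show that neither \<open>k1\<close> nor \<open>k2\<close> belongs to the set \<open>S\<close> of
    \<open>capture\<close>.\<close>
  define U where "U = (\<lambda>y. (y, act k1 (ub w0))) -` (- {p. fst p \<le> snd p}) \<inter>
      (\<lambda>y. (act k2 (ub w0), y)) -` (- {p. fst p \<le> snd p})"
  have U_iff: "y \<in> U \<longleftrightarrow> \<not> y \<le> act k1 (ub w0) \<and> \<not> act k2 (ub w0) \<le> y" for y
    by (simp add: U_def)
  have "open U"
    unfolding U_def using cone by (intro open_Int open_vimage continuous_intros open_Compl)
  moreover have "ub w0 \<in> U"
    using k1 k2 by (simp add: U_iff)
  ultimately obtain \<eta> where "\<eta> > 0" and \<eta>: "cball (ub w0) \<eta> \<subseteq> U"
    unfolding open_contains_cball by blast

  \<comment> \<open>Choice of the radii\<close>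
  define \<epsilon> where "\<epsilon> = min \<eta> (\<delta> / 2)"
  have \<epsilon>: "\<epsilon> > 0" "\<epsilon> \<le> \<eta>" "\<epsilon> < \<delta>"
    using \<open>\<eta> > 0\<close> \<open>\<delta> > 0\<close> by (auto simp: \<epsilon>_def)
  \<comment> \<open>Taking the unit \<open>0\<close> as group element gives stability of
    \<open>K\<close> itself.\<close>
  obtain d0 where d0: "d0 > 0" "\<And>\<omega> y t. \<omega> \<in> \<Omega> \<Longrightarrow> y \<in> X \<Longrightarrow> norm (y - act 0 (ub \<omega>)) < d0 \<Longrightarrow> 0 \<le> t \<Longrightarrow>
      norm (u t y \<omega> - act 0 (ub (\<phi> \<omega> t))) < \<epsilon>"
    using stable_translate[OF \<epsilon>(1)] by blast
  define d where "d = min d0 (\<delta> / 2)"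
  have d: "d > 0" "d < \<delta>" "d \<le> d0"
    using d0 \<open>\<delta> > 0\<close> by (auto simp: d_def)

  \<comment> \<open>Omega-limit sets of orbits starting close to \<open>K\<close>\<close>
  have in_tube: "(x, \<omega>) \<in> tube X \<Omega> ub \<delta>" if "(x, \<omega>) \<in> tube X \<Omega> ub d" for x \<omega>
    using that d by (auto simp: tube_def)
  have cpt: "compact (closure (forward_orbit u \<phi> (x, \<omega>)))" if "(x, \<omega>) \<in> tube X \<Omega> ub d" for x \<omega>
    using in_tube[OF that] by (rule assms(20))
  have limit_close: "norm (y - ub w) \<le> \<epsilon>" "y \<in> X" "w \<in> \<Omega>"
    if xt: "(x, \<omega>) \<in> tube X \<Omega> ub d" and yw: "(y, w) \<in> omega_limit u \<phi> (x, \<omega>)" for x \<omega> y w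
  proof -
    have x: "x \<in> X" "\<omega> \<in> \<Omega>" "norm (x - ub \<omega>) < d0"
      using xt d by (auto simp: tube_def)
    show "y \<in> X" and w: "w \<in> \<Omega>"
      using omega_limit_subset[OF x(1,2) yw] .
    have "norm (u t x \<omega> - act 0 (ub (\<phi> \<omega> t))) \<le> \<epsilon>" if "t \<ge> 0" for t
      using less_imp_le[OF d0(2)[OF x(2,1) _ that]] x by (simp add: act_zero ub_in)
    from omega_limit_norm_le[OF x(2) yw w this] show "norm (y - ub w) \<le> \<epsilon>"
      by (simp add: act_zero ub_in w)
  qed
  \<comment> \<open>Limits satisfy only the weak bound by \<open>\<epsilon>\<close>; the strict
    inequality \<open>\<epsilon> < \<delta>\<close> puts them into the tube required by hypothesis
    (ii).\<close>
  have limit_tube: "omega_limit u \<phi> (x, \<omega>) \<subseteq> tube X \<Omega> ub \<delta>" if "(x, \<omega>) \<in> tube X \<Omega> ub d" for x \<omega>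
    using limit_close[OF that] \<epsilon>(3) by (fastforce simp: tube_def)
  have fibre: "\<exists>y. (y, w) \<in> omega_limit u \<phi> (x, \<omega>)" if "(x, \<omega>) \<in> tube X \<Omega> ub d" "w \<in> \<Omega>" for x \<omega> w
    using omega_limit_fibre[OF cpt[OF that(1)] _ that(2)] that(1) by (auto simp: tube_def)
  have less_iff:
    "sets_less (omega_limit u \<phi> (x, \<omega>)) (translate act h K) \<longleftrightarrow>
       (\<forall>(y, w)\<in>omega_limit u \<phi> (x, \<omega>). y \<le> act h (ub w) \<and> act h (ub w) \<noteq> y)"
    "sets_less (translate act h K) (omega_limit u \<phi> (x, \<omega>)) \<longleftrightarrow>
       (\<forall>(y, w)\<in>omega_limit u \<phi> (x, \<omega>). act h (ub w) \<le> y \<and> act h (ub w) \<noteq> y)"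
    if xt: "(x, \<omega>) \<in> tube X \<Omega> ub d" for x \<omega> h
    unfolding assms(15) translate_graph
    by (rule sets_less_graph_iff; erule limit_close(3)[OF xt] fibre[OF xt])+

  \<comment> \<open>Orbits starting below \<open>K\<close>\<close>
  have below: "\<exists>h. omega_limit u \<phi> (x, \<omega>) = translate act h K"
    if xt: "(x, \<omega>) \<in> tube X \<Omega> ub d" and "x \<le> ub \<omega>" for x \<omega>
  proof -
    have x: "x \<in> X" "\<omega> \<in> \<Omega>"
      using xt by (auto simp: tube_def)
    obtain y0 where y0: "(y0, w0) \<in> omega_limit u \<phi> (x, \<omega>)"
      using fibre[OF xt g(1)] by blast
    have "y0 \<in> cball (ub w0) \<eta>"
      using limit_close(1)[OF xt y0] \<epsilon>(2) by (simp add: dist_norm norm_minus_commute)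
    from subsetD[OF \<eta> this] have k: "\<not> act k1 (ub w0) \<ge> y0"
      by (simp add: U_iff)
    \<comment> \<open>By monotonicity the orbit stays below \<open>K\<close>, hence so do its limit
      points. Thus the unit is the initial translate for \<open>capture\<close>, used with the
      reversed order, and \<open>k1\<close> is the excluded one.\<close>
    have "y \<le> act 0 (ub w)" if yw: "(y, w) \<in> omega_limit u \<phi> (x, \<omega>)" for y w
    proof -
      obtain \<tau> where \<tau>: "\<And>n. 0 \<le> \<tau> n" "(\<lambda>n. u (\<tau> n) x \<omega>) \<longlonglongrightarrow> y" "(\<lambda>n. \<phi> \<omega> (\<tau> n)) \<longlonglongrightarrow> w"
        using omega_limitE[OF yw] by blast
      have lim: "(\<lambda>n. (u (\<tau> n) x \<omega>, act 0 (ub (\<phi> \<omega> (\<tau> n))))) \<longlonglongrightarrow> (y, act 0 (ub w))"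
        using \<tau> x limit_close(3)[OF xt yw] by (intro tendsto_Pair act_b_tendsto) (auto simp: flow_in)
      have "u (\<tau> n) x \<omega> \<le> act 0 (ub (\<phi> \<omega> (\<tau> n)))" for n
        using mono[OF \<tau>(1) x(2,1) ub_in[OF x(2)] \<open>x \<le> ub \<omega>\<close>, of n] \<tau>(1) x
        by (simp add: act_zero ub_in ub_inv flow_in)
      then show ?thesis
        using closed_sequentially[OF cone(1) _ lim] by simp
    qed
    moreover have "\<exists>B. open B \<and> 0 \<in> B \<and> (\<forall>g\<in>B. \<forall>(y, w)\<in>omega_limit u \<phi> (x, \<omega>).
        act (g + h) (ub w) \<ge> y \<and> act (g + h) (ub w) \<noteq> y)"
      if "\<And>y w. (y, w) \<in> omega_limit u \<phi> (x, \<omega>) \<Longrightarrow> act h (ub w) \<ge> y \<and> act h (ub w) \<noteq> y" for h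
      using assms(21)[OF in_tube[OF xt] limit_tube[OF xt], of h] that
      unfolding less_iff[OF xt] by blast
    ultimately obtain h where "omega_limit u \<phi> (x, \<omega>) = translate act h (graph_over \<Omega> ub)"
      by (rule capture[where R = "\<lambda>a c. c \<le> a", OF assms(10) cone(2) x cpt[OF xt] _ _ y0 k])
    then show ?thesis
      unfolding assms(15) ..
  qed

  \<comment> \<open>Orbits whose omega-limit set lies above a translate of \<open>K\<close>\<close>
  have above: "\<exists>g. omega_limit u \<phi> (x, \<omega>) = translate act g K \<and>
        ((\<lambda>t. norm (u t x \<omega> - act g (ub (\<phi> \<omega> t)))) \<longlongrightarrow> 0) at_top"
    if xt: "(x, \<omega>) \<in> tube X \<Omega> ub d"
      and h: "\<And>y w. (y, w) \<in> omega_limit u \<phi> (x, \<omega>) \<Longrightarrow> act h (ub w) \<le> y" for x \<omega> h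
  proof -
    have x: "x \<in> X" "\<omega> \<in> \<Omega>"
      using xt by (auto simp: tube_def)
    obtain y0 where y0: "(y0, w0) \<in> omega_limit u \<phi> (x, \<omega>)"
      using fibre[OF xt g(1)] by blast
    have "y0 \<in> cball (ub w0) \<eta>"
      using limit_close(1)[OF xt y0] \<epsilon>(2) by (simp add: dist_norm norm_minus_commute)
    from subsetD[OF \<eta> this] have k: "\<not> act k2 (ub w0) \<le> y0"
      by (simp add: U_iff)
    have "\<exists>B. open B \<and> 0 \<in> B \<and> (\<forall>g\<in>B. \<forall>(y, w)\<in>omega_limit u \<phi> (x, \<omega>).
        act (g + h) (ub w) \<le> y \<and> act (g + h) (ub w) \<noteq> y)"
      if "\<And>y w. (y, w) \<in> omega_limit u \<phi> (x, \<omega>) \<Longrightarrow> act h (ub w) \<le> y \<and> act h (ub w) \<noteq> y" for h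
      using assms(22)[OF in_tube[OF xt] limit_tube[OF xt], of h] that
      unfolding less_iff[OF xt] by blast
    from h this obtain g where "omega_limit u \<phi> (x, \<omega>) = translate act g (graph_over \<Omega> ub)"
      "((\<lambda>t. norm (u t x \<omega> - act g (ub (\<phi> \<omega> t)))) \<longlongrightarrow> 0) at_top"
      by (rule capture[where R = "(\<le>)", OF assms(10) cone(1) x cpt[OF xt] _ _ y0 k])
    then show ?thesis
      unfolding assms(15) by blast
  qed

  \<comment> \<open>Reduction of general starting points by meets\<close>
  let ?m = "\<lambda>(a, c). meet_in X a c"
  have glb: "glb_in X a c (?m (a, c))" if "a \<in> X" "c \<in> X" for a c
    using assms(4) that meet_in_eqI unfolding has_continuous_meets_def prod.case by metis
  have "continuous_on (X \<times> X) ?m"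
    using assms(4) by (simp add: has_continuous_meets_def)
  moreover have "compact ((\<lambda>\<omega>. (ub \<omega>, ub \<omega>)) ` \<Omega>)"
    by (intro compact_continuous_image continuous_intros b_cont compact_base)
  moreover have "(\<lambda>\<omega>. (ub \<omega>, ub \<omega>)) ` \<Omega> \<subseteq> X \<times> X"
    using ub_in by auto
  ultimately obtain e where e: "e > 0" "\<And>c y. c \<in> (\<lambda>\<omega>. (ub \<omega>, ub \<omega>)) ` \<Omega> \<Longrightarrow> y \<in> X \<times> X \<Longrightarrow>
      dist c y < e \<Longrightarrow> dist (?m c) (?m y) < d"
    \<comment> \<open>The compact set is the diagonal over \<open>ub\<close>, on which the meet is
      \<open>ub \<omega>\<close> itself; so for \<open>x\<close> within \<open>e\<close> of
      \<open>ub \<omega>\<close> the meet of \<open>x\<close> and \<open>ub \<omega>\<close> stays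
      within \<open>d\<close> of \<open>ub \<omega>\<close>.\<close>
    by (rule uniform_continuity_near_compact[OF _ _ _ d(1)]) blast

  show ?thesis
  \<comment> \<open>\<open>d\<close> controls the orbit of \<open>x\<close>, and \<open>e\<close>
    puts its meet with \<open>ub \<omega>\<close> into the \<open>d\<close>-tube.\<close>
  proof (intro exI[of _ "min d e"] conjI allI impI)
    fix x \<omega> assume "(x, \<omega>) \<in> tube X \<Omega> ub (min d e)"
    then have x: "x \<in> X" "\<omega> \<in> \<Omega>" "norm (x - ub \<omega>) < e" and xt: "(x, \<omega>) \<in> tube X \<Omega> ub d"
      by (auto simp: tube_def)
    define z where "z = ?m (x, ub \<omega>)"
    have z: "z \<in> X" "z \<le> x" "z \<le> ub \<omega>"
      using glb[OF x(1) ub_in[OF x(2)]] by (auto simp: z_def glb_in_def)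
    have "?m (ub \<omega>, ub \<omega>) = ub \<omega>"
      using meet_in_eqI[of X "ub \<omega>" "ub \<omega>" "ub \<omega>"] ub_in[OF x(2)] by (simp add: glb_in_def)
    moreover have "dist (?m (ub \<omega>, ub \<omega>)) (?m (x, ub \<omega>)) < d"
      using x ub_in by (intro e(2)) (auto simp: dist_Pair_Pair dist_norm norm_minus_commute)
    ultimately have zt: "(z, \<omega>) \<in> tube X \<Omega> ub d"
      using z x by (simp add: tube_def z_def dist_norm norm_minus_commute)
    then obtain h where h: "omega_limit u \<phi> (z, \<omega>) = translate act h K"
      using below z(3) by blast
    have "act h (ub w) \<le> y" if yw: "(y, w) \<in> omega_limit u \<phi> (x, \<omega>)" for y w
    proof -
      obtain \<tau> where \<tau>: "\<And>n. 0 \<le> \<tau> n" "filterlim \<tau> at_top sequentially"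
        "(\<lambda>n. u (\<tau> n) x \<omega>) \<longlonglongrightarrow> y" "(\<lambda>n. \<phi> \<omega> (\<tau> n)) \<longlonglongrightarrow> w"
        using omega_limitE[OF yw] by blast
      \<comment> \<open>The orbits of \<open>z\<close> and \<open>x\<close> are followed along the
        same times, so that \<open>z \<le> x\<close> passes to limits over the same
        \<open>w\<close>; the limit for \<open>z\<close> can only be the point of \<open>hK\<close>
        there.\<close>
      obtain r z' where r: "strict_mono r" and z': "(\<lambda>n. u (\<tau> (r n)) z \<omega>) \<longlonglongrightarrow> z'"
        "(z', w) \<in> omega_limit u \<phi> (z, \<omega>)"
        using omega_limit_subseq[OF cpt[OF zt] \<tau>(1,2,4)] by blast
      have "(\<lambda>n. u (\<tau> (r n)) x \<omega>) \<longlonglongrightarrow> y"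
        using LIMSEQ_subseq_LIMSEQ[OF \<tau>(3) r] by (simp add: o_def)
      from closed_sequentially[OF cone(1) _ tendsto_Pair[OF z'(1) this]] have "z' \<le> y"
        using mono[OF \<tau>(1) x(2) z(1) x(1) z(2)] by simp
      moreover have "z' = act h (ub w)"
        using z'(2) h by (auto simp: translate_graph)
      ultimately show ?thesis by simp
    qed
    then show "\<exists>h. omega_limit u \<phi> (x, \<omega>) = translate act h K \<and>
        ((\<lambda>t. norm (u t x \<omega> - act h (ub (\<phi> \<omega> t)))) \<longlongrightarrow> 0) at_top"
      using above[OF xt] by blast
  qed (use d e in auto)
qed

end
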